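(* Let $C_1,C_2,C_3,\ldots$ be a (not necessarily closed) chain of circles in the Euclidean plane such that neighbouring circles $C_i,C_{i+1}$ intersect in two points or touch each other, and let $A_i$ be a common point of $C_i$ and $C_{i+1}$. For a starting point $X_1\in C_1$ let $X_{i+1}=\varphi_{A_i}(X_i)$, where $\varphi_{A_i}:C_i\to C_{i+1}$ is the pivot map with pivot $A_i$, let $\ell_i$ be the line through $X_i,A_i,X_{i+1}$, and let $X_{jk}$ be the intersection of the lines $\ell_j$ and $\ell_k$. Then the intersection $X_{jk}$ of the lines $\ell_j$ and $\ell_k$ lies on a fixed circle $C_{jk}$ through the points $A_j$ and $A_k$, no matter what the position of the initial point $X_1$ on $C_1$ is. The circles $C_{ij},C_{jk},C_{ki}$ are concurrent in a point $P_{ijk}$ for all triples $i,j,k$.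
   Context: Pivot map: let $C,C'$ be two circles which intersect in two points or touch each other, and let $A$ be a common point. The map $\varphi_A:C\to C'$ is defined as follows. If $X\in C$, $X\ne A$, then $\varphi_A(X)$ is the second intersection point of the line $XA$ with $C'$ (equal to $A$ if this line is tangent to $C'$ at $A$). If $X=A$, then $\varphi_A(X)$ is the second intersection with $C'$ of the tangent to $C$ at $A$ (equal to $A$ if the circles touch at $A$). The line $\ell_i$ is the line $X_iA_i$ if $X_i\ne A_i$, and the tangent to $C_i$ at $A_i$ if $X_i=A_i$. For neighbouring indices one writes $X_{i-1,i}$ for $X_i$ and $C_{i-1,i}$ for $C_i$.
   Formalization: If A_j ≠ A_k and the lines l_j, l_k are parallel or equal for every X_1, so that X_jk never exists, C_jk is taken to be the line A_jA_k; concurrency is claimed for distinct i, j, k unless all three of C_ij, C_jk, C_ki are such lines. *)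

theory Defs
  imports "HOL-Analysis.Analysis"
begin

text \<open>The Euclidean plane is the type \<^typ>\<open>complex\<close> with its real inner product. A chain of
  circles is given by sequences \<open>c\<close>, \<open>r\<close> of centres and radii and a sequence \<open>A\<close> of pivots,
  where \<open>A i\<close> is a common point of the \<open>i\<close>-th and the \<open>Suc i\<close>-th circle; indices start at 0.\<close>

definition is_circle :: "complex set \<Rightarrow> bool" where
  "is_circle S \<longleftrightarrow> (\<exists>m \<rho>. \<rho> > 0 \<and> S = sphere m \<rho>)"

text \<open>Tangent at \<open>P\<close> to the circle with centre \<open>m\<close> through \<open>P\<close>.\<close>

definition tangent_line :: "complex \<Rightarrow> complex \<Rightarrow> complex set" where
  "tangent_line m P = {Z. (Z - P) \<bullet> (P - m) = 0}"

text \<open>The line joining a point \<open>X\<close> of the circle with centre \<open>m\<close> to the pivot \<open>P\<close> on that circle.\<close>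

definition pivot_line :: "complex \<Rightarrow> complex \<Rightarrow> complex \<Rightarrow> complex set" where
  "pivot_line m P X = (if X = P then tangent_line m P else affine hull {X, P})"

text \<open>A line \<open>L\<close> through the point \<open>P\<close> of a circle \<open>S\<close> has second intersection \<open>Y\<close> with \<open>S\<close> iff
  \<open>L \<inter> S = {P, Y}\<close>; if \<open>L\<close> is tangent to \<open>S\<close>, this gives \<open>Y = P\<close>.\<close>

definition pivot_map ::
    "complex \<Rightarrow> complex \<Rightarrow> real \<Rightarrow> complex \<Rightarrow> complex \<Rightarrow> complex" where
  "pivot_map m m' \<rho>' P X = (THE Y. pivot_line m P X \<inter> sphere m' \<rho>' = {P, Y})"

definition pivot_orbit ::
    "(nat \<Rightarrow> complex) \<Rightarrow> (nat \<Rightarrow> real) \<Rightarrow> (nat \<Rightarrow> complex) \<Rightarrow> (nat \<Rightarrow> complex) \<Rightarrow> bool" where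
  "pivot_orbit c r A X \<longleftrightarrow>
     X 0 \<in> sphere (c 0) (r 0) \<and>
     (\<forall>i. X (Suc i) = pivot_map (c i) (c (Suc i)) (r (Suc i)) (A i) (X i))"

definition chain_line ::
    "(nat \<Rightarrow> complex) \<Rightarrow> (nat \<Rightarrow> complex) \<Rightarrow> (nat \<Rightarrow> complex) \<Rightarrow> nat \<Rightarrow> complex set" where
  "chain_line c A X i = pivot_line (c i) (A i) (X i)"

text \<open>\<open>Y\<close> is the intersection of the \<open>j\<close>-th and the \<open>k\<close>-th line. The lines with indices \<open>i\<close> and
  \<open>Suc i\<close> always share the point \<open>X (Suc i)\<close>, which is taken as their intersection even if the
  two lines coincide (this happens if \<open>A i = A (Suc i)\<close>).\<close>

definition crossing_point ::
    "(nat \<Rightarrow> complex) \<Rightarrow> (nat \<Rightarrow> complex) \<Rightarrow> (nat \<Rightarrow> complex) \<Rightarrow> nat \<Rightarrow> nat \<Rightarrow> complex \<Rightarrow> bool" where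
  "crossing_point c A X j k Y \<longleftrightarrow>
     chain_line c A X j \<inter> chain_line c A X k = {Y} \<or>
     k = Suc j \<and> Y = X k \<or>
     j = Suc k \<and> Y = X j"

text \<open>The angle between two of the lines does not depend on the starting point, so the failure of
  this condition means that the two lines are parallel (or equal) for every starting point.\<close>

definition lines_cross ::
    "(nat \<Rightarrow> complex) \<Rightarrow> (nat \<Rightarrow> real) \<Rightarrow> (nat \<Rightarrow> complex) \<Rightarrow> nat \<Rightarrow> nat \<Rightarrow> bool" where
  "lines_cross c r A j k \<longleftrightarrow> (\<exists>X Y. pivot_orbit c r A X \<and> crossing_point c A X j k Y)"

end

theory Submission
  imports Defs
begin

text \<open>When the starting point moves, all lines turn rigidly about their pivots: there are fixed unit
  directions \<open>dir i\<close> such that the \<open>i\<close>-th line has direction \<open>w * dir i\<close>, with the same unit \<open>w\<close> for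
  all \<open>i\<close>. So the angle between two lines is constant and they meet on a fixed circle through their
  pivots. Three such circles are concurrent because for some \<open>w\<close> the three lines are.\<close>

section \<open>Lines given by a unit direction and their second intersection with a circle\<close>

definition dir_line :: "complex \<Rightarrow> complex \<Rightarrow> complex set" where
  "dir_line P u = {z. Im ((z - P) * cnj u) = 0}"

lemma mult_cnj_unit: "cmod u = 1 \<Longrightarrow> u * cnj u = 1"
  by (metis complex_norm_square of_real_1 one_power2)

lemma mem_dir_line_unit_iff:
  assumes "cmod u = 1"
  shows "z \<in> dir_line P u \<longleftrightarrow> (\<exists>t. z = P + of_real t * u)"
proof
  assume "z \<in> dir_line P u"
  then have "(z - P) * cnj u = of_real (Re ((z - P) * cnj u))"
    by (simp add: dir_line_def complex_eq_iff)
  then have "(z - P) * (u * cnj u) = of_real (Re ((z - P) * cnj u)) * u"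
    by (metis mult.assoc mult.commute)
  then have "z = P + of_real (Re ((z - P) * cnj u)) * u"
    using mult_cnj_unit[OF assms] by (simp add: algebra_simps)
  then show "\<exists>t. z = P + of_real t * u" by blast
next
  assume "\<exists>t. z = P + of_real t * u"
  then show "z \<in> dir_line P u"
    using mult_cnj_unit[OF assms] by (auto simp: dir_line_def mult.assoc)
qed

text \<open>A chord is symmetric about the diameter perpendicular to it, and the second point given
  here is the mirror image of \<open>P\<close> in that diameter. The formula also covers tangents,
  where the mirror image is \<open>P\<close> itself.\<close>

lemma dir_line_Int_sphere:
  assumes "cmod u = 1" and P: "P \<in> sphere m \<rho>"
  shows "dir_line P u \<inter> sphere m \<rho> = {P, m - u\<^sup>2 * cnj (P - m)}"
proof -
  define p where "p = P - m"
  have u: "u * cnj u = 1" using mult_cnj_unit[OF assms(1)] .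
  have \<rho>: "cmod p = \<rho>" using P by (simp add: p_def dist_norm norm_minus_commute)
  have sph: "z \<in> sphere m \<rho> \<longleftrightarrow> (z - m) * cnj (z - m) = p * cnj p" for z
  proof -
    have "\<rho> \<ge> 0" using \<rho> by auto
    have "z \<in> sphere m \<rho> \<longleftrightarrow> cmod (z - m) = cmod p"
      using \<rho> by (simp add: dist_norm norm_minus_commute)
    also have "\<dots> \<longleftrightarrow> (cmod (z - m))\<^sup>2 = (cmod p)\<^sup>2" by simp
    also have "\<dots> \<longleftrightarrow> (z - m) * cnj (z - m) = p * cnj p"
      by (metis complex_norm_square of_real_eq_iff)
    finally show ?thesis .
  qed
  have key: "(p + of_real t * u) * cnj (p + of_real t * u) = p * cnj p \<longleftrightarrow>
      t = 0 \<or> of_real t = - (p * cnj u + cnj p * u)" for t :: real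
  proof -
    have "(p + of_real t * u) * cnj (p + of_real t * u) - p * cnj p =
        of_real t * (of_real t * (u * cnj u) + (p * cnj u + cnj p * u))"
      by (simp add: algebra_simps)
    then have "(p + of_real t * u) * cnj (p + of_real t * u) - p * cnj p = 0 \<longleftrightarrow>
        of_real t * (of_real t + (p * cnj u + cnj p * u)) = 0"
      by (simp only: u mult_1_right)
    then show ?thesis
      by (simp only: right_minus_eq mult_eq_0_iff of_real_eq_0_iff eq_neg_iff_add_eq_0)
  qed
  \<comment> \<open>The second root of \<open>key\<close> as a real number. It vanishes when
    \<open>u\<close> is perpendicular to the radius \<open>p\<close>, so that both roots give
    \<open>P\<close>.\<close>
  define s where "s = - (2 * Re (p * cnj u))"
  have s: "of_real s = - (p * cnj u + cnj p * u)"
    by (simp add: s_def complex_eq_iff)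
  have ps: "p + of_real s * u = - (u\<^sup>2 * cnj p)"
  proof -
    have "p + of_real s * u = p - p * (u * cnj u) - cnj p * u\<^sup>2"
      by (simp add: s algebra_simps power2_eq_square)
    then show ?thesis using u by simp
  qed
  have "z \<in> dir_line P u \<inter> sphere m \<rho> \<longleftrightarrow> z = P \<or> z = m - u\<^sup>2 * cnj (P - m)" for z
  proof -
    have "z \<in> dir_line P u \<inter> sphere m \<rho> \<longleftrightarrow>
        (\<exists>t. z - m = p + of_real t * u \<and> (z - m) * cnj (z - m) = p * cnj p)"
      unfolding Int_iff mem_dir_line_unit_iff[OF assms(1)] sph p_def
      by (auto simp: algebra_simps)
    also have "\<dots> \<longleftrightarrow> (\<exists>t. z - m = p + of_real t * u \<and>
        (t = 0 \<or> of_real t = - (p * cnj u + cnj p * u)))"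
      using key by metis
    also have "\<dots> \<longleftrightarrow> (\<exists>t. z - m = p + of_real t * u \<and> (t = 0 \<or> t = s))"
      unfolding s[symmetric] of_real_eq_iff ..
    also have "\<dots> \<longleftrightarrow> z - m = p \<or> z - m = - (u\<^sup>2 * cnj p)"
      using ps by (metis (no_types) add.right_neutral mult_zero_left of_real_0)
    also have "\<dots> \<longleftrightarrow> z = P \<or> z = m - u\<^sup>2 * cnj (P - m)"
      by (auto simp: p_def algebra_simps)
    finally show ?thesis .
  qed
  then show ?thesis by blast
qed

section \<open>Pivot lines and the pivot map in terms of directions\<close>

lemma pivot_map_eq:
  assumes "cmod u = 1" "P \<in> sphere m' \<rho>'" "pivot_line m P X = dir_line P u"
  shows "pivot_map m m' \<rho>' P X = m' - u\<^sup>2 * cnj (P - m')"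
  unfolding pivot_map_def assms(3) dir_line_Int_sphere[OF assms(1,2)]
  \<comment> \<open>Uniqueness survives tangency: \<open>{P, Y} = {P, Y'}\<close> forces
    \<open>Y = Y'\<close> even if one of them is \<open>P\<close>.\<close>
  by (rule the_equality) (auto simp: doubleton_eq_iff)

lemma affine_hull_eq_dir_line:
  assumes "cmod u = 1" "X \<in> dir_line P u" "X \<noteq> P"
  shows "affine hull {X, P} = dir_line P u"
proof -
  obtain t where t: "X = P + of_real t * u"
    using assms mem_dir_line_unit_iff by blast
  with \<open>X \<noteq> P\<close> have t0: "t \<noteq> 0" by auto
  have "affine hull {X, P} = {P + s *\<^sub>R (X - P) | s. True}"
    by (metis affine_hull_2_alt full_SetCompr_eq insert_commute)
  also have "\<dots> = {P + of_real (s * t) * u | s. True}"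
    by (simp add: t scaleR_conv_of_real mult.assoc)
  also have "\<dots> = dir_line P u"
    unfolding set_eq_iff mem_dir_line_unit_iff[OF assms(1)]
    using t0 by (auto intro: exI[of _ "_ / t"])
       (metis nonzero_divide_eq_eq of_real_mult)
  finally show ?thesis .
qed

text \<open>Converse direction: describing \<open>X\<close> through \<open>u\<close> treats both
  branches of \<open>pivot_line\<close> uniformly, because \<open>X = P\<close> happens only if
  \<open>u\<close> is a tangent direction.\<close>

lemma pivot_line_eq_dir_line:
  assumes "cmod u = 1" "P \<in> sphere m \<rho>" "\<rho> > 0" and X: "X = m - u\<^sup>2 * cnj (P - m)"
  shows "pivot_line m P X = dir_line P u"
proof (cases "X = P")
  case True
  define p where "p = P - m"
  have p0: "p \<noteq> 0" using assms(2,3) by (auto simp: p_def)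
  have u: "u * cnj u = 1" using mult_cnj_unit[OF assms(1)] .
  \<comment> \<open>A point fixed by the reflection makes \<open>p * cnj u\<close> purely imaginary,
    so the radius \<open>p\<close> is perpendicular to \<open>u\<close>.\<close>
  have "p = - u\<^sup>2 * cnj p" using X True by (simp add: p_def algebra_simps)
  then have "p * cnj u = - (u * (u * cnj u) * cnj p)"
    by (metis (no_types, lifting) mult.assoc mult.commute mult_minus_left power2_eq_square)
  then have "p * cnj u + cnj (p * cnj u) = 0" using u by (simp add: mult.commute)
  then have "Re (p * cnj u) = 0" by (simp add: complex_eq_iff)
  then obtain s where "p * cnj u = \<i> * of_real s"
    by (metis complex_eq mult_zero_left add_0 of_real_0)
  then have "p * (u * cnj u) = \<i> * of_real s * u" by (metis mult.assoc mult.commute)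
  then have ps: "p = \<i> * of_real s * u" by (simp add: u)
  then have s: "s \<noteq> 0" using p0 by auto
  have "(z - P) \<bullet> p = 0 \<longleftrightarrow> Im ((z - P) * cnj u) = 0" for z
  proof -
    have "(z - P) \<bullet> p = s * Im ((z - P) * cnj u)"
      by (simp add: ps inner_complex_def algebra_simps)
    then show ?thesis using s by simp
  qed
  then show ?thesis
    using True by (simp add: pivot_line_def tangent_line_def dir_line_def p_def)
next
  case False
  have "X \<in> dir_line P u"
    using dir_line_Int_sphere[OF assms(1,2)] X by blast
  then show ?thesis
    using affine_hull_eq_dir_line[OF assms(1) _ False] False by (simp add: pivot_line_def)
qed

section \<open>The locus of the crossings of two lines turning together\<close>

text \<open>For \<open>q = cnj u * v\<close> this is the set of points in which a line through \<open>P\<close> with direction \<open>w * u\<close>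
  meets the line through \<open>Q\<close> with direction \<open>w * v\<close>, for varying \<open>w\<close>.\<close>

definition pencil_locus :: "complex \<Rightarrow> complex \<Rightarrow> complex \<Rightarrow> complex set" where
  "pencil_locus q P Q = {z. Im (q * (z - P) * cnj (z - Q)) = 0}"

lemma pencil_locus_commute: "pencil_locus q P Q = pencil_locus (cnj q) Q P"
proof -
  have "Im (q * (z - P) * cnj (z - Q)) = - Im (cnj q * (z - Q) * cnj (z - P))" for z
    by (simp add: algebra_simps)
  then show ?thesis by (simp only: pencil_locus_def neg_equal_0_iff_equal)
qed

text \<open>Inscribed angle theorem: the centre sees \<open>P\<close> and \<open>Q\<close> under
  twice the angle of \<open>q\<close>. Expanding the product, its imaginary part becomes
  \<open>Im q\<close> times the power of \<open>z\<close> with respect to the circle.\<close>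

lemma pencil_locus_eq_sphere:
  assumes q: "cmod q = 1" "Im q \<noteq> 0" and P: "P \<in> sphere m \<rho>" and Q: "Q - m = q\<^sup>2 * (P - m)"
  shows "pencil_locus q P Q = sphere m \<rho>"
proof -
  have qq: "q * cnj q = 1" using mult_cnj_unit[OF q(1)] .
  have "Im (q * (z - P) * cnj (z - Q)) = Im q * ((cmod (z - m))\<^sup>2 - (cmod (P - m))\<^sup>2)" for z
  proof -
    define x p where "x = z - m" and "p = P - m"
    have "z - P = x - p" "z - Q = x - (Q - m)" by (simp_all add: x_def p_def)
    then have "q * (z - P) * cnj (z - Q) = q * (x - p) * cnj (x - q\<^sup>2 * p)"
      by (simp only: Q p_def)
    also have "\<dots> = q * (x * cnj x) - (q * cnj q) * cnj q * x * cnj p - q * p * cnj x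
        + (q * cnj q) * cnj q * (p * cnj p)"
      by (simp add: algebra_simps power2_eq_square)
    also have "\<dots> = q * of_real ((cmod x)\<^sup>2) - (q * p * cnj x + cnj (q * p * cnj x))
        + cnj q * of_real ((cmod p)\<^sup>2)"
      unfolding qq complex_norm_square by (simp add: algebra_simps)
    finally have "Im (q * (z - P) * cnj (z - Q)) = Im q * ((cmod x)\<^sup>2 - (cmod p)\<^sup>2)"
      by (simp only: Im_complex_of_real plus_complex.simps minus_complex.simps complex_cnj)
         (simp add: algebra_simps)
    then show ?thesis by (simp add: x_def p_def)
  qed
  moreover have "cmod (P - m) = \<rho>" using P by (simp add: dist_norm norm_minus_commute)
  moreover have "\<rho> \<ge> 0" using calculation(2) by auto
  ultimately show ?thesis
    using q(2) by (auto simp: pencil_locus_def dist_norm norm_minus_commute)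
qed

lemma is_circle_pencil_locus:
  assumes q: "cmod q = 1" "Im q \<noteq> 0" and "P \<noteq> Q"
  shows "is_circle (pencil_locus q P Q)"
proof -
  have q2: "q\<^sup>2 \<noteq> 1"
    using q(2) by (auto simp: power2_eq_1_iff)
  \<comment> \<open>The solution of \<open>Q - m = q\<^sup>2 * (P - m)\<close>, which is linear in
    \<open>m\<close>.\<close>
  define m where "m = (Q - q\<^sup>2 * P) / (1 - q\<^sup>2)"
  have "m * (1 - q\<^sup>2) = Q - q\<^sup>2 * P" using q2 by (simp add: m_def)
  then have Q: "Q - m = q\<^sup>2 * (P - m)" by (simp add: algebra_simps)
  have "P \<noteq> m" using Q \<open>P \<noteq> Q\<close> by auto
  moreover have "pencil_locus q P Q = sphere m (dist m P)"
    by (rule pencil_locus_eq_sphere[OF q _ Q]) simp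
  ultimately show ?thesis unfolding is_circle_def by (metis zero_less_dist_iff)
qed

text \<open>The degenerate case of parallel lines: \<open>q\<close> is 1 or -1, so the condition
  says that \<open>z - P\<close> and \<open>z - Q\<close> are real-linearly dependent.\<close>

lemma pencil_locus_real:
  assumes q: "cmod q = 1" "Im q = 0" and "P \<noteq> Q"
  shows "pencil_locus q P Q = affine hull {P, Q}"
proof -
  define u where "u = sgn (P - Q)"
  have u: "cmod u = 1" using assms by (simp add: u_def norm_sgn)
  have PQ: "P - Q = of_real (cmod (P - Q)) * u"
    using assms by (simp add: u_def sgn_eq)
  have n0: "cmod (P - Q) \<noteq> 0" using assms by simp
  have q0: "Re q \<noteq> 0" using q by (metis cmod_eq_Re abs_zero zero_neq_one)
  have *: "Im (q * (z - P) * cnj (z - Q)) = Re q * (cmod (P - Q) * Im ((z - Q) * cnj u))" for z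
  proof -
    have "Im (q * (z - P) * cnj (z - Q)) = Re q * Im ((z - P) * cnj (z - Q))"
      using q(2) by (simp add: algebra_simps)
    also have "Im ((z - P) * cnj (z - Q)) = Im ((z - Q) * cnj (P - Q))"
      by (simp add: algebra_simps)
    also have "Im ((z - Q) * cnj (P - Q)) = cmod (P - Q) * Im ((z - Q) * cnj u)"
      by (subst PQ) (simp add: algebra_simps)
    finally show ?thesis by simp
  qed
  have "pencil_locus q P Q = dir_line Q u"
    unfolding pencil_locus_def dir_line_def * using q0 n0 by auto
  also have "\<dots> = affine hull {P, Q}"
    using affine_hull_eq_dir_line[OF u _ \<open>P \<noteq> Q\<close>] PQ mem_dir_line_unit_iff[OF u]
    by (metis add.commute diff_add_cancel)
  finally show ?thesis .
qed

lemma not_is_circle_affine_hull: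
  assumes "P \<noteq> Q"
  shows "\<not> is_circle (affine hull {P, Q})"
proof
  assume "is_circle (affine hull {P, Q})"
  then have "bounded (affine hull {P, Q})"
    by (auto simp: is_circle_def)
  then have "affine hull {P, Q} = {} \<or> (\<exists>a. affine hull {P, Q} = {a})"
    using affine_bounded_eq_trivial affine_affine_hull by blast
  then show False
    using assms hull_subset[of "{P, Q}" affine] by auto
qed

section \<open>Common points of two and of three lines\<close>

lemma dir_lines_meet_pencil_locus:
  assumes "u \<noteq> 0" "v \<noteq> 0" "z \<in> dir_line P u" "z \<in> dir_line Q v"
  shows "z \<in> pencil_locus (cnj u * v) P Q"
proof -
  \<comment> \<open>By membership in the lines both bracketed factors are real. The argument applies
    to coinciding lines as well.\<close>
  have "cnj u * v * (z - P) * cnj (z - Q) = ((z - P) * cnj u) * cnj ((z - Q) * cnj v)"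
    by (simp add: algebra_simps)
  then have "Im (cnj u * v * (z - P) * cnj (z - Q)) = Im (((z - P) * cnj u) * cnj ((z - Q) * cnj v))"
    by metis
  also have "\<dots> = 0" using assms(3,4) unfolding dir_line_def by (simp del: complex_cnj_mult)
  finally show ?thesis by (simp add: pencil_locus_def)
qed

lemma dir_lines_crossing:
  assumes "Im (cnj u * v) \<noteq> 0"
  obtains z where "dir_line P u \<inter> dir_line Q v = {z}"
proof -
  define k where "k = Re u * Im v - Im u * Re v"
  have k0: "k \<noteq> 0" using assms by (simp add: k_def)
  define a b where "a = Im (P * cnj u)" and "b = Im (Q * cnj v)"
  \<comment> \<open>Cramer's rule for the equations of the two lines, with determinant
    \<open>k = Im (cnj u * v)\<close>.\<close>
  define x y where "x = (a * Re v - b * Re u) / k" and "y = (a * Im v - b * Im u) / k"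
  have "z \<in> dir_line P u \<inter> dir_line Q v \<longleftrightarrow> z = Complex x y" for z
  proof -
    have "z \<in> dir_line P u \<inter> dir_line Q v \<longleftrightarrow>
        Im z * Re u - Re z * Im u = a \<and> Im z * Re v - Re z * Im v = b"
      by (simp add: dir_line_def a_def b_def algebra_simps)
    also have "\<dots> \<longleftrightarrow> Re z * k = a * Re v - b * Re u \<and> Im z * k = a * Im v - b * Im u"
      (is "?l \<longleftrightarrow> ?r")
    proof
      assume ?l
      then have ab: "a = Im z * Re u - Re z * Im u" "b = Im z * Re v - Re z * Im v" by auto
      show ?r unfolding ab k_def by (simp add: algebra_simps)
    next
      assume ?r
      then have "k * (Im z * Re u - Re z * Im u) = k * a" "k * (Im z * Re v - Re z * Im v) = k * b"
        unfolding k_def by algebra+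
      then show ?l using k0 by simp
    qed
    also have "\<dots> \<longleftrightarrow> z = Complex x y"
      using k0 by (auto simp: x_def y_def complex_eq_iff field_simps)
    finally show ?thesis .
  qed
  then show ?thesis using that by blast
qed

text \<open>A common point can be moved by \<open>u\<close> along both lines at once.\<close>

lemma dir_lines_parallel:
  assumes "cmod u = 1" "cmod v = 1" "Im (cnj u * v) = 0"
  shows "dir_line P u \<inter> dir_line Q v \<noteq> {z}"
proof
  assume z: "dir_line P u \<inter> dir_line Q v = {z}"
  then have "Im ((z - P) * cnj u) = 0" "Im ((z - Q) * cnj v) = 0"
    by (auto simp: dir_line_def)
  moreover have "Im ((z + u - P) * cnj u) = Im ((z - P) * cnj u)"
    using mult_cnj_unit[OF assms(1)] by (simp add: algebra_simps)
  moreover have "Im ((z + u - Q) * cnj v) = Im ((z - Q) * cnj v) - Im (cnj u * v)"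
    by (simp add: algebra_simps)
  ultimately have "z + u \<in> dir_line P u \<inter> dir_line Q v"
    using assms(3) by (simp add: dir_line_def)
  then show False using z assms(1) by auto
qed

text \<open>Among the directions there is a linear relation, and three lines with directions turned by
  \<open>w\<close> are concurrent iff the same relation holds for their offsets; the latter is one real linear
  equation for \<open>w\<close>, hence solvable.\<close>

lemma turned_lines_concurrent:
  assumes "Im (cnj u1 * u2) \<noteq> 0"
  obtains w z where "cmod w = 1"
    "z \<in> dir_line P1 (w * u1)" "z \<in> dir_line P2 (w * u2)" "z \<in> dir_line P3 (w * u3)"
proof -
  define k where "k = Re u1 * Im u2 - Im u1 * Re u2"
  have k0: "k \<noteq> 0" using assms by (simp add: k_def)
  \<comment> \<open>Cramer's rule again: these are the coordinates of \<open>u3\<close> in the basis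
    \<open>u1\<close>, \<open>u2\<close>.\<close>
  define \<alpha> \<beta> where "\<alpha> = Im (cnj u3 * u2) / k" and "\<beta> = Im (cnj u1 * u3) / k"
  have ku3: "of_real k * u3 = of_real (\<alpha> * k) * u1 + of_real (\<beta> * k) * u2"
    using k0 by (simp add: \<alpha>_def \<beta>_def complex_eq_iff) (simp add: k_def algebra_simps)
  have "of_real k * u3 = of_real k * (of_real \<alpha> * u1 + of_real \<beta> * u2)"
    unfolding ku3 by (simp add: algebra_simps)
  then have u3: "u3 = of_real \<alpha> * u1 + of_real \<beta> * u2"
    using k0 by (metis mult_left_cancel of_real_eq_0_iff)
  \<comment> \<open>\<open>Im (K * cnj w)\<close> measures by how much the crossing of the first two
    turned lines misses the third.\<close>
  define K where "K = P3 * cnj u3 - of_real \<alpha> * P1 * cnj u1 - of_real \<beta> * P2 * cnj u2"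
  \<comment> \<open>The direction of \<open>K\<close> makes \<open>K * cnj w\<close> real, so the
    defect vanishes.\<close>
  define w where "w = (if K = 0 then 1 else sgn K)"
  have w: "cmod w = 1" by (simp add: w_def norm_sgn)
  have "\<exists>s. K = of_real s * w" by (auto simp: w_def sgn_eq intro: exI[of _ "cmod K"])
  then have Kw: "Im (K * cnj w) = 0"
    using mult_cnj_unit[OF w] by (auto simp: mult.assoc)
  have "cnj (w * u1) * (w * u2) = (w * cnj w) * (cnj u1 * u2)" by (simp add: algebra_simps)
  then have "Im (cnj (w * u1) * (w * u2)) \<noteq> 0"
    using assms mult_cnj_unit[OF w] by (metis mult_1)
  then obtain z where z: "z \<in> dir_line P1 (w * u1)" "z \<in> dir_line P2 (w * u2)"
    using dir_lines_crossing by (metis IntD1 IntD2 insertI1)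
  have Im_of_real_mult: "Im (of_real s * x) = s * Im x" for s x by simp
  have z3: "(z - P3) * cnj (w * u3) = of_real \<alpha> * ((z - P1) * cnj (w * u1))
      + of_real \<beta> * ((z - P2) * cnj (w * u2)) - K * cnj w"
    by (simp add: u3 K_def algebra_simps)
  have "Im ((z - P3) * cnj (w * u3)) = \<alpha> * Im ((z - P1) * cnj (w * u1))
      + \<beta> * Im ((z - P2) * cnj (w * u2)) - Im (K * cnj w)"
    unfolding z3 by (simp only: plus_complex.sel minus_complex.sel Im_of_real_mult)
  then have "z \<in> dir_line P3 (w * u3)"
    using z Kw by (simp add: dir_line_def)
  with w z show ?thesis using that by blast
qed

section \<open>Chains of circles and their orbits\<close>

locale pivot_chain =
  fixes c :: "nat \<Rightarrow> complex" and r :: "nat \<Rightarrow> real" and A :: "nat \<Rightarrow> complex"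
  assumes r_pos: "r i > 0"
    and A_left: "A i \<in> sphere (c i) (r i)"
    and A_right: "A i \<in> sphere (c (Suc i)) (r (Suc i))"
begin

text \<open>By the inscribed angle theorem, passing from one line to the next turns it by half the angle
  under which the two pivots are seen from the centre of their common circle.\<close>

primrec dir :: "nat \<Rightarrow> complex" where
  "dir 0 = 1"
| "dir (Suc i) = dir i * csqrt ((A (Suc i) - c (Suc i)) / (A i - c (Suc i)))"

lemma norm_diff_centre:
  "cmod (A i - c i) = r i" "cmod (A i - c (Suc i)) = r (Suc i)"
  using A_left[of i] A_right[of i] by (auto simp: dist_norm norm_minus_commute)

lemma norm_dir: "cmod (dir i) = 1"
  using r_pos by (induction i) (auto simp: norm_mult norm_divide norm_diff_centre less_imp_neq[symmetric])

lemma cnj_dir_mult_dir_Suc: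
  "cnj (dir i) * dir (Suc i) = csqrt ((A (Suc i) - c (Suc i)) / (A i - c (Suc i)))"
proof -
  have "cnj (dir i) * dir (Suc i) =
      (dir i * cnj (dir i)) * csqrt ((A (Suc i) - c (Suc i)) / (A i - c (Suc i)))"
    by (simp add: algebra_simps)
  then show ?thesis using mult_cnj_unit[OF norm_dir] by simp
qed

text \<open>By \<open>dir_line_Int_sphere\<close> this is the point other than \<open>A i\<close>,
  or \<open>A i\<close> itself at tangency, in which the \<open>i\<close>-th turned line meets the
  \<open>i\<close>-th circle.\<close>

definition orbit_point :: "complex \<Rightarrow> nat \<Rightarrow> complex" where
  "orbit_point w i = c i - (w * dir i)\<^sup>2 * cnj (A i - c i)"

text \<open>The same point, seen from the previous pivot: lines \<open>i\<close> and
  \<open>Suc i\<close> meet on their common circle. The square of the root in \<open>dir\<close> is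
  \<open>b / a\<close>, and \<open>b / a * cnj b = cnj a\<close> because both pivots have the same
  distance from the centre.\<close>

lemma orbit_point_Suc:
  "orbit_point w (Suc i) = c (Suc i) - (w * dir i)\<^sup>2 * cnj (A i - c (Suc i))"
proof -
  define a b where "a = A i - c (Suc i)" and "b = A (Suc i) - c (Suc i)"
  have "cmod a = r (Suc i)" "cmod b = r (Suc i)"
    by (simp_all add: a_def b_def norm_diff_centre)
  then have "a * cnj a = b * cnj b" "a \<noteq> 0"
    using r_pos[of "Suc i"] by (auto simp flip: complex_norm_square)
  then have "b / a * cnj b = cnj a" by (simp add: field_simps)
  moreover have "(w * dir (Suc i))\<^sup>2 * cnj b = (w * dir i)\<^sup>2 * (b / a * cnj b)"
    by (simp add: power_mult_distrib mult.assoc flip: a_def b_def)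
  ultimately have "(w * dir (Suc i))\<^sup>2 * cnj b = (w * dir i)\<^sup>2 * cnj a" by simp
  then show ?thesis by (simp add: orbit_point_def a_def b_def)
qed

lemma pivot_line_orbit_point:
  assumes "cmod w = 1"
  shows "pivot_line (c i) (A i) (orbit_point w i) = dir_line (A i) (w * dir i)"
  by (rule pivot_line_eq_dir_line[OF _ A_left r_pos])
     (simp_all add: norm_mult assms norm_dir orbit_point_def)

lemma pivot_map_orbit_point:
  assumes "cmod w = 1"
  shows "pivot_map (c i) (c (Suc i)) (r (Suc i)) (A i) (orbit_point w i) = orbit_point w (Suc i)"
  unfolding orbit_point_Suc
  by (rule pivot_map_eq[OF _ A_right pivot_line_orbit_point[OF assms]])
     (simp add: norm_mult assms norm_dir)

lemma pivot_orbit_orbit_point: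
  assumes "cmod w = 1"
  shows "pivot_orbit c r A (orbit_point w)"
  unfolding pivot_orbit_def pivot_map_orbit_point[OF assms]
  using r_pos[of 0]
  by (simp add: orbit_point_def dist_norm norm_mult norm_power assms norm_diff_centre flip: complex_cnj_diff)

lemma pivot_orbitE:
  assumes "pivot_orbit c r A X"
  obtains w where "cmod w = 1" "X = orbit_point w"
proof -
  \<comment> \<open>Since \<open>dir 0 = 1\<close>, the equation
    \<open>X 0 = orbit_point w 0\<close> prescribes the square of \<open>w\<close>; the pivot maps
    then determine the rest of the orbit.\<close>
  define w where "w = csqrt (- ((X 0 - c 0) / cnj (A 0 - c 0)))"
  have X0: "cmod (X 0 - c 0) = r 0"
    using assms by (simp add: pivot_orbit_def dist_norm norm_minus_commute)
  have n: "cmod (cnj (A 0 - c 0)) = r 0"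
    unfolding complex_mod_cnj by (rule norm_diff_centre)
  then have "cnj (A 0 - c 0) \<noteq> 0" using r_pos[of 0] by force
  then have "X 0 = orbit_point w 0"
    by (simp add: orbit_point_def w_def del: complex_cnj_diff)
  moreover have w: "cmod w = 1"
    using r_pos[of 0] X0 n by (simp add: w_def norm_divide del: complex_cnj_diff)
  ultimately have "X i = orbit_point w i" for i
    using assms by (induction i) (simp_all add: pivot_orbit_def pivot_map_orbit_point)
  with w that show ?thesis by blast
qed

lemma chain_line_orbit_point:
  "cmod w = 1 \<Longrightarrow> chain_line c A (orbit_point w) i = dir_line (A i) (w * dir i)"
  by (simp add: chain_line_def pivot_line_orbit_point)

lemma orbit_point_Suc_mem:
  assumes "cmod w = 1"
  shows "orbit_point w (Suc i) \<in> dir_line (A i) (w * dir i)"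
    and "orbit_point w (Suc i) \<in> dir_line (A (Suc i)) (w * dir (Suc i))"
    and "orbit_point w (Suc i) \<in> sphere (c (Suc i)) (r (Suc i))"
proof -
  have n: "cmod (w * dir j) = 1" for j by (simp add: norm_mult assms norm_dir)
  show "orbit_point w (Suc i) \<in> dir_line (A i) (w * dir i)"
    "orbit_point w (Suc i) \<in> sphere (c (Suc i)) (r (Suc i))"
    unfolding orbit_point_Suc using dir_line_Int_sphere[OF n[of i] A_right] by blast+
  show "orbit_point w (Suc i) \<in> dir_line (A (Suc i)) (w * dir (Suc i))"
    unfolding orbit_point_def using dir_line_Int_sphere[OF n[of "Suc i"] A_left] by blast
qed

section \<open>Crossing lines and the circles carrying their intersections\<close>

definition crosses :: "nat \<Rightarrow> nat \<Rightarrow> bool" where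
  "crosses j k \<longleftrightarrow> Im (cnj (dir j) * dir k) \<noteq> 0"

text \<open>The common turn \<open>w\<close> cancels, so the angle between two lines is the same for
  all starting points. This is what makes the locus of their crossings fixed.\<close>

lemma turned_dir:
  assumes "cmod w = 1"
  shows "cnj (w * dir j) * (w * dir k) = cnj (dir j) * dir k"
proof -
  have "cnj (w * dir j) * (w * dir k) = (w * cnj w) * (cnj (dir j) * dir k)"
    by (simp add: algebra_simps)
  then show ?thesis using mult_cnj_unit[OF assms] by simp
qed

lemma crosses_commute: "crosses j k \<longleftrightarrow> crosses k j"
  by (auto simp: crosses_def algebra_simps)

text \<open>Parallelism does not depend on \<open>w\<close>, so the orbit with \<open>w = 1\<close>
  already decides it; neighbouring lines cross by the convention in
  \<open>crossing_point\<close>.\<close>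

lemma lines_cross_iff:
  "lines_cross c r A j k \<longleftrightarrow> crosses j k \<or> k = Suc j \<or> j = Suc k"
proof
  assume "lines_cross c r A j k"
  then obtain X Y where XY: "pivot_orbit c r A X" "crossing_point c A X j k Y"
    by (auto simp: lines_cross_def)
  then obtain w where w: "cmod w = 1" "X = orbit_point w" by (metis pivot_orbitE)
  have n: "cmod (w * dir j) = 1" for j by (simp add: norm_mult w norm_dir)
  show "crosses j k \<or> k = Suc j \<or> j = Suc k"
    using XY(2) dir_lines_parallel[OF n n]
    by (auto simp: crossing_point_def chain_line_orbit_point w turned_dir crosses_def
        simp del: complex_cnj_mult)
next
  assume R: "crosses j k \<or> k = Suc j \<or> j = Suc k"
  have "\<exists>Y. crossing_point c A (orbit_point 1) j k Y"
  proof (cases "crosses j k")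
    case True
    then obtain z where "dir_line (A j) (dir j) \<inter> dir_line (A k) (dir k) = {z}"
      unfolding crosses_def by (rule dir_lines_crossing)
    then show ?thesis by (auto simp: crossing_point_def chain_line_orbit_point)
  next
    case False
    then show ?thesis using R by (auto simp: crossing_point_def)
  qed
  then show "lines_cross c r A j k"
    using pivot_orbit_orbit_point[of 1] by (auto simp: lines_cross_def)
qed

text \<open>If \<open>A j = A k\<close> and the indices are not neighbours, the lines can only meet in \<open>A j\<close>, and every
  circle through this point will do.\<close>

definition cross_circle :: "nat \<Rightarrow> nat \<Rightarrow> complex set" where
  "cross_circle j k =
    (if k = Suc j then sphere (c k) (r k)
     else if j = Suc k then sphere (c j) (r j)
     else if A j = A k then sphere (A j + 1) 1
     else pencil_locus (cnj (dir j) * dir k) (A j) (A k))"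

lemma norm_cnj_dir_mult_dir: "cmod (cnj (dir j) * dir k) = 1"
  by (simp add: norm_mult norm_dir)

lemma cross_circle_commute: "cross_circle j k = cross_circle k j"
  using pencil_locus_commute[of "cnj (dir j) * dir k" "A j" "A k"]
  by (auto simp: cross_circle_def mult.commute)

text \<open>For neighbours the locus is the given circle of the chain: \<open>q\<^sup>2\<close>
  rotates one pivot to the other about its centre. A real \<open>q\<close> would have square 1 and
  make the pivots equal.\<close>

lemma crosses_Suc_and_sphere:
  assumes "A i \<noteq> A (Suc i)"
  shows "crosses i (Suc i)"
    and "pencil_locus (cnj (dir i) * dir (Suc i)) (A i) (A (Suc i)) = sphere (c (Suc i)) (r (Suc i))"
proof -
  define a b where "a = A i - c (Suc i)" and "b = A (Suc i) - c (Suc i)"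
  define q where "q = csqrt (b / a)"
  have ab: "cmod a = r (Suc i)" "cmod b = r (Suc i)"
    by (simp_all add: a_def b_def norm_diff_centre)
  then have a0: "a \<noteq> 0" using r_pos[of "Suc i"] by auto
  have q2: "b = q\<^sup>2 * a" using a0 by (simp add: q_def)
  have nq: "cmod q = 1" using ab r_pos[of "Suc i"] by (simp add: q_def norm_divide)
  have "a \<noteq> b" using assms by (simp add: a_def b_def)
  have "q\<^sup>2 = 1" if "Im q = 0"
  proof -
    have "cnj q = q" using that by (simp add: complex_eq_iff)
    then show ?thesis using mult_cnj_unit[OF nq] by (simp add: power2_eq_square)
  qed
  then have "Im q \<noteq> 0" using \<open>a \<noteq> b\<close> q2 by auto
  moreover have qd: "cnj (dir i) * dir (Suc i) = q"
    unfolding cnj_dir_mult_dir_Suc by (simp add: q_def a_def b_def)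
  ultimately show "crosses i (Suc i)" by (simp only: crosses_def not_False_eq_True)
  show "pencil_locus (cnj (dir i) * dir (Suc i)) (A i) (A (Suc i)) = sphere (c (Suc i)) (r (Suc i))"
    unfolding qd using q2
    by (intro pencil_locus_eq_sphere[OF nq \<open>Im q \<noteq> 0\<close> A_right]) (simp add: a_def b_def)
qed

lemma cross_circle_eq_pencil_locus:
  assumes "A j \<noteq> A k"
  shows "cross_circle j k = pencil_locus (cnj (dir j) * dir k) (A j) (A k)"
  using assms crosses_Suc_and_sphere(2)[of j] crosses_Suc_and_sphere(2)[of k]
    pencil_locus_commute[of "cnj (dir j) * dir k" "A j" "A k"]
  by (auto simp: cross_circle_def mult.commute)

lemma is_circle_sphere: "\<rho> > 0 \<Longrightarrow> is_circle (sphere m \<rho>)"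
  by (auto simp: is_circle_def)

lemma is_circle_cross_circle:
  assumes "lines_cross c r A j k \<or> A j = A k"
  shows "is_circle (cross_circle j k)"
proof (cases "A j = A k")
  case True
  then show ?thesis by (auto simp: cross_circle_def is_circle_sphere r_pos)
next
  case False
  then have "crosses j k"
    using assms crosses_Suc_and_sphere(1) crosses_commute unfolding lines_cross_iff by metis
  then show ?thesis
    unfolding cross_circle_eq_pencil_locus[OF False]
    by (intro is_circle_pencil_locus norm_cnj_dir_mult_dir False) (simp only: crosses_def not_False_eq_True)
qed

lemma cross_circle_eq_line:
  assumes "A j \<noteq> A k" "\<not> crosses j k"
  shows "cross_circle j k = affine hull {A j, A k}"
  unfolding cross_circle_eq_pencil_locus[OF assms(1)]
  by (rule pencil_locus_real[OF norm_cnj_dir_mult_dir _ assms(1)])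
     (use assms(2) in \<open>simp only: crosses_def not_not\<close>)

lemma pivot_mem_cross_circle: "A j \<in> cross_circle j k" "A k \<in> cross_circle j k"
proof -
  have "A j \<in> cross_circle j k" for j k
    using A_left A_right by (auto simp: cross_circle_def pencil_locus_def dist_norm)
  then show "A j \<in> cross_circle j k" "A k \<in> cross_circle j k"
    using cross_circle_commute by blast+
qed

lemma crossing_point_mem_cross_circle:
  assumes "pivot_orbit c r A X" "crossing_point c A X j k Y" "j \<noteq> k"
  shows "Y \<in> cross_circle j k"
proof -
  obtain w where w: "cmod w = 1" "X = orbit_point w" by (metis assms(1) pivot_orbitE)
  have w0: "w * dir i \<noteq> 0" for i using w(1) norm_dir[of i] by auto
  have Y: "dir_line (A j) (w * dir j) \<inter> dir_line (A k) (w * dir k) = {Y} \<or>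
      k = Suc j \<and> Y = orbit_point w k \<or> j = Suc k \<and> Y = orbit_point w j"
    using assms(2) by (simp add: crossing_point_def chain_line_orbit_point w)
  then have Y2: "Y \<in> dir_line (A j) (w * dir j)" "Y \<in> dir_line (A k) (w * dir k)"
    using orbit_point_Suc_mem(1,2)[OF w(1)] by auto
  show ?thesis
  proof (cases "A j = A k")
    case False
    show ?thesis
      using dir_lines_meet_pencil_locus[OF w0 w0 Y2]
      unfolding cross_circle_eq_pencil_locus[OF False] turned_dir[OF w(1)] .
  next
    case True
    consider "k = Suc j" | "j = Suc k" | "k \<noteq> Suc j" "j \<noteq> Suc k" by blast
    then show ?thesis
    proof cases
      case 1
      \<comment> \<open>If the lines meet in \<open>Y\<close> only, the orbit point, which lies on
        both, must be \<open>Y\<close>.\<close>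
      then have "Y = orbit_point w k" using Y orbit_point_Suc_mem(1,2)[OF w(1), of j] by auto
      then show ?thesis using orbit_point_Suc_mem(3)[OF w(1), of j] 1 by (simp add: cross_circle_def)
    next
      case 2
      then have "Y = orbit_point w j" using Y orbit_point_Suc_mem(1,2)[OF w(1), of k] by auto
      then show ?thesis using orbit_point_Suc_mem(3)[OF w(1), of k] 2 by (simp add: cross_circle_def)
    next
      case 3
      have "A j \<in> dir_line (A j) (w * dir j) \<inter> dir_line (A k) (w * dir k)"
        using True by (simp add: dir_line_def)
      then have "Y = A j" using Y 3 by (metis singletonD)
      then show ?thesis using pivot_mem_cross_circle(1) by simp
    qed
  qed
qed

section \<open>Concurrence of three circles\<close>

lemma cross_circles_concurrent_distinct:
  assumes "A i \<noteq> A j" "A j \<noteq> A k" "A k \<noteq> A i" and "crosses i j"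
  shows "\<exists>P. P \<in> cross_circle i j \<and> P \<in> cross_circle j k \<and> P \<in> cross_circle k i"
proof -
  have "Im (cnj (dir i) * dir j) \<noteq> 0" using assms(4) unfolding crosses_def .
  \<comment> \<open>For this special turn the three lines share \<open>z\<close>, which is therefore
    a crossing of each pair and lies on all three loci.\<close>
  then obtain w z where w: "cmod w = 1" and z: "z \<in> dir_line (A i) (w * dir i)"
      "z \<in> dir_line (A j) (w * dir j)" "z \<in> dir_line (A k) (w * dir k)"
    using turned_lines_concurrent by metis
  have w0: "w * dir i \<noteq> 0" for i using w norm_dir[of i] by auto
  note mem = dir_lines_meet_pencil_locus[OF w0 w0, unfolded turned_dir[OF w]]
  show ?thesis
    using mem[OF z(1,2)] mem[OF z(2,3)] mem[OF z(3,1)] assms(1-3)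
    by (auto simp: cross_circle_eq_pencil_locus)
qed

text \<open>For distinct pivots and parallel lines the locus is an unbounded line.\<close>

lemma crosses_if_is_circle:
  assumes "is_circle (cross_circle j k)" "A j \<noteq> A k"
  shows "crosses j k"
  using assms cross_circle_eq_line not_is_circle_affine_hull by metis

lemma cross_circles_concurrent:
  assumes "is_circle (cross_circle i j) \<or> is_circle (cross_circle j k) \<or> is_circle (cross_circle k i)"
  shows "\<exists>P. P \<in> cross_circle i j \<and> P \<in> cross_circle j k \<and> P \<in> cross_circle k i"
proof (cases "A i = A j \<or> A j = A k \<or> A k = A i")
  case True
  \<comment> \<open>A pivot shared by two of the indices lies on all three circles.\<close>
  then show ?thesis using pivot_mem_cross_circle by metis
next
  case False
  \<comment> \<open>One genuine circle gives one pair of nonparallel lines, and the claim is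
    invariant under cyclic renaming.\<close>
  then consider "crosses i j" | "crosses j k" | "crosses k i"
    using assms crosses_if_is_circle by metis
  then show ?thesis
    using False cross_circles_concurrent_distinct[of i j k]
      cross_circles_concurrent_distinct[of j k i] cross_circles_concurrent_distinct[of k i j]
    by cases metis+
qed

end

theorem lemma14:
  fixes c :: "nat \<Rightarrow> complex" and r :: "nat \<Rightarrow> real" and A :: "nat \<Rightarrow> complex"
  assumes "\<And>i. r i > 0"
    and "\<And>i. card (sphere (c i) (r i) \<inter> sphere (c (Suc i)) (r (Suc i))) = 2 \<or>
              card (sphere (c i) (r i) \<inter> sphere (c (Suc i)) (r (Suc i))) = 1"
    and "\<And>i. A i \<in> sphere (c i) (r i) \<inter> sphere (c (Suc i)) (r (Suc i))"
  shows "\<exists>D :: nat \<Rightarrow> nat \<Rightarrow> complex set.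
    (\<forall>j k. D j k = D k j) \<and>
    (\<forall>i. D i (Suc i) = sphere (c (Suc i)) (r (Suc i))) \<and>
    (\<forall>j k. j \<noteq> k \<longrightarrow>
       (if lines_cross c r A j k \<or> A j = A k then is_circle (D j k)
        else D j k = affine hull {A j, A k}) \<and>
       A j \<in> D j k \<and> A k \<in> D j k \<and>
       (\<forall>X Y. pivot_orbit c r A X \<and> crossing_point c A X j k Y \<longrightarrow> Y \<in> D j k)) \<and>
    (\<forall>i j k. i \<noteq> j \<and> j \<noteq> k \<and> k \<noteq> i \<and>
       (is_circle (D i j) \<or> is_circle (D j k) \<or> is_circle (D k i)) \<longrightarrow>
       (\<exists>P. P \<in> D i j \<and> P \<in> D j k \<and> P \<in> D k i))"
proof -
  interpret pivot_chain c r A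
    using assms by unfold_locales auto
  show ?thesis
  proof (rule exI[of _ cross_circle], intro conjI allI impI)
    fix j k :: nat assume "j \<noteq> k"
    show "if lines_cross c r A j k \<or> A j = A k then is_circle (cross_circle j k)
        else cross_circle j k = affine hull {A j, A k}"
      using is_circle_cross_circle[of j k] cross_circle_eq_line[of j k] by (auto simp: lines_cross_iff)
    fix X Y assume "pivot_orbit c r A X \<and> crossing_point c A X j k Y"
    then show "Y \<in> cross_circle j k"
      using crossing_point_mem_cross_circle \<open>j \<noteq> k\<close> by blast
  next
    show "cross_circle i (Suc i) = sphere (c (Suc i)) (r (Suc i))" for i
      by (simp add: cross_circle_def)
  qed (use cross_circle_commute pivot_mem_cross_circle cross_circles_concurrent in blast)+
qed

end
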